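(* Let $k$ be a field of characteristic zero, let $R$ be a UFD which is a finitely generated $k$-algebra, and let $B=R[X_1,X_2]$ be the polynomial ring in two variables over $R$. Let $D$ be an irreducible locally nilpotent $R$-derivation on $B$ which is not fixed point free, and let $A=\mathrm{Ker}(D)$. Suppose that the following conditions hold: (i) $b:=DX_1\in R$ is irreducible; (ii) $DX_2=-f'(X_1)$, where $f(X_1)=\sum_{i=0}^{m}f_iX_1^i\in R[X_1]$ with $f_m\neq 0$; (iii) $D$ is strictly $1$-quasi-nice. Let $d=\max\{i\in\mathbb{N}: i\leqslant m \text{ and } b\nmid f_i\}$. Then $d\geqslant 2$, and for each $j\geqslant 2$, $$I_j=b^{m_j}\bar{I_j},$$ where $I_j=A\cap D^jB$ is the $j$-th image ideal of $D$, $m_j=\min\{i_1+(d-1)i_2: i_1,i_2\in\mathbb{N},\ i_1+di_2=j\}$, $\bar{I_j}=(b,f_d)^{l_j}A$ and $l_j=[j/d]$ (the integer part of $j/d$).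
   Context: All rings are commutative with unity; $\mathbb{N}$ is the set of non-negative integers. A locally nilpotent $R$-derivation on an $R$-algebra $B$ is an $R$-linear map $D:B\to B$ satisfying the Leibniz rule such that for each $b\in B$ there is $n\in\mathbb{N}$ with $D^n b=0$; $\mathrm{Ker}(D)=\{b\in B: Db=0\}$. For $j\geqslant 1$, the $j$-th image ideal of $D$ is the ideal $I_j=\mathrm{Ker}(D)\cap D^jB$ of $\mathrm{Ker}(D)$. $D$ is irreducible if there is no non-unit $b\in B$ with $DB\subseteq bB$. $D$ is fixed point free if $(DB)B=B$, i.e. the ideal of $B$ generated by $DB$ is $B$. For $B$ a polynomial ring in $n$ variables over $R$ and $1\leqslant m\leqslant n$, a locally nilpotent $R$-derivation $D$ of $B$ is $m$-quasi-nice if there is a coordinate system $Y_1,\dots,Y_n$ of $B$ (i.e. $B=R[Y_1,\dots,Y_n]$) such that $D^2(Y_i)=0$ for all $i\in\{1,\dots,m\}$; it is strictly $m$-quasi-nice if it is $m$-quasi-nice but not $r$-quasi-nice for any positive integer $r>m$. Here $f'$ is the derivative of $f$ with respect to $X_1$. *)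

theory Defs
  imports "HOL-Computational_Algebra.Computational_Algebra"
begin

text \<open>
  Subrings are sets inside a type of class \<open>comm_ring_1\<close>; \<open>is_subring hull S\<close> is the
  subring generated by \<open>S\<close>, and \<open>is_ideal A hull S\<close> the ideal of \<open>A\<close> generated by \<open>S\<close>.
\<close>

definition is_subring :: "'a::comm_ring_1 set \<Rightarrow> bool" where
  "is_subring S \<longleftrightarrow> 0 \<in> S \<and> 1 \<in> S \<and>
     (\<forall>x\<in>S. \<forall>y\<in>S. x + y \<in> S \<and> x * y \<in> S) \<and> (\<forall>x\<in>S. - x \<in> S)"

definition is_ideal :: "'a::comm_ring_1 set \<Rightarrow> 'a set \<Rightarrow> bool" where
  "is_ideal A I \<longleftrightarrow> I \<subseteq> A \<and> 0 \<in> I \<and>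
     (\<forall>x\<in>I. \<forall>y\<in>I. x + y \<in> I) \<and> (\<forall>a\<in>A. \<forall>x\<in>I. a * x \<in> I)"

primrec ideal_power :: "'a::comm_ring_1 set \<Rightarrow> 'a set \<Rightarrow> nat \<Rightarrow> 'a set" where
  "ideal_power A I 0 = A"
| "ideal_power A I (Suc n) = is_ideal A hull {x * y | x y. x \<in> I \<and> y \<in> ideal_power A I n}"

text \<open>A \<open>k\<close>-algebra structure on \<open>R\<close> is given by its structure map \<open>\<phi>\<close>.\<close>

definition is_ring_hom :: "('k::comm_ring_1 \<Rightarrow> 'r::comm_ring_1) \<Rightarrow> bool" where
  "is_ring_hom \<phi> \<longleftrightarrow> \<phi> 1 = 1 \<and>
     (\<forall>x y. \<phi> (x + y) = \<phi> x + \<phi> y) \<and> (\<forall>x y. \<phi> (x * y) = \<phi> x * \<phi> y)"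

definition finitely_generated_algebra :: "('k::comm_ring_1 \<Rightarrow> 'r::comm_ring_1) \<Rightarrow> bool" where
  "finitely_generated_algebra \<phi> \<longleftrightarrow>
     is_ring_hom \<phi> \<and> (\<exists>S. finite S \<and> is_subring hull (range \<phi> \<union> S) = UNIV)"

text \<open>
  \<open>R[X\<^sub>1, X\<^sub>2]\<close> is represented as \<open>R[X\<^sub>1][X\<^sub>2]\<close>, i.e. by \<open>'r poly poly\<close>: the inner variable is
  \<open>X\<^sub>1\<close>, the outer one \<open>X\<^sub>2\<close>. A polynomial \<open>f\<close> over \<open>R\<close> in \<open>X\<^sub>1\<close> is thus embedded as \<open>[:f:]\<close>.
\<close>

abbreviation const2 :: "'r::comm_ring_1 \<Rightarrow> 'r poly poly" where
  "const2 r \<equiv> [:[:r:]:]"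

abbreviation X1 :: "'r::comm_ring_1 poly poly" where
  "X1 \<equiv> [:[:0, 1:]:]"

abbreviation X2 :: "'r::comm_ring_1 poly poly" where
  "X2 \<equiv> [:0, 1:]"

definition derivation :: "('r::comm_ring_1 poly poly \<Rightarrow> 'r poly poly) \<Rightarrow> bool" where
  "derivation D \<longleftrightarrow>
     (\<forall>p q. D (p + q) = D p + D q) \<and>
     (\<forall>r p. D (const2 r * p) = const2 r * D p) \<and>
     (\<forall>p q. D (p * q) = p * D q + q * D p)"

definition locally_nilpotent_derivation :: "('r::comm_ring_1 poly poly \<Rightarrow> 'r poly poly) \<Rightarrow> bool" where
  "locally_nilpotent_derivation D \<longleftrightarrow> derivation D \<and> (\<forall>p. \<exists>n. (D ^^ n) p = 0)"

definition Ker :: "('r::comm_ring_1 poly poly \<Rightarrow> 'r poly poly) \<Rightarrow> 'r poly poly set" where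
  "Ker D = {p. D p = 0}"

definition image_ideal :: "('r::comm_ring_1 poly poly \<Rightarrow> 'r poly poly) \<Rightarrow> nat \<Rightarrow> 'r poly poly set" where
  "image_ideal D j = Ker D \<inter> range (D ^^ j)"

definition irreducible_derivation :: "('r::comm_ring_1 poly poly \<Rightarrow> 'r poly poly) \<Rightarrow> bool" where
  "irreducible_derivation D \<longleftrightarrow> \<not> (\<exists>b. \<not> b dvd 1 \<and> range D \<subseteq> range ((*) b))"

definition fixed_point_free :: "('r::comm_ring_1 poly poly \<Rightarrow> 'r poly poly) \<Rightarrow> bool" where
  "fixed_point_free D \<longleftrightarrow> is_ideal UNIV hull (range D) = UNIV"

text \<open>
  A coordinate system consists of \<open>Y 1\<close>, \<open>Y 2\<close> with \<open>B = R[Y 1, Y 2]\<close>, i.e. they generate \<open>B\<close> as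
  an \<open>R\<close>-algebra. Their algebraic independence over \<open>R\<close> is then automatic, since a surjective
  endomorphism of a finitely generated commutative algebra is injective.
\<close>

definition coordinate_system :: "(nat \<Rightarrow> 'r::comm_ring_1 poly poly) \<Rightarrow> bool" where
  "coordinate_system Y \<longleftrightarrow> is_subring hull (range const2 \<union> Y ` {1..2}) = UNIV"

definition quasi_nice :: "nat \<Rightarrow> ('r::comm_ring_1 poly poly \<Rightarrow> 'r poly poly) \<Rightarrow> bool" where
  "quasi_nice m D \<longleftrightarrow> 1 \<le> m \<and> m \<le> 2 \<and> locally_nilpotent_derivation D \<and>
     (\<exists>Y. coordinate_system Y \<and> (\<forall>i\<in>{1..m}. (D ^^ 2) (Y i) = 0))"

definition strictly_quasi_nice :: "nat \<Rightarrow> ('r::comm_ring_1 poly poly \<Rightarrow> 'r poly poly) \<Rightarrow> bool" where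
  "strictly_quasi_nice m D \<longleftrightarrow> quasi_nice m D \<and> (\<forall>r>m. \<not> quasi_nice r D)"

end

theory Submission
  imports Defs
begin

text \<open>
  Put \<open>F = b X\<^sub>2 + f(X\<^sub>1)\<close>, which \<open>D\<close> kills. Since \<open>b\<close> divides the coefficients of \<open>f\<close> beyond \<open>d\<close>,
  one can write \<open>f = f\<^sub>0 + b g\<close> with \<open>f\<^sub>0\<close> of degree \<open>d\<close> and leading coefficient \<open>f\<^sub>d\<close>. Then
  \<open>Z = X\<^sub>2 + g(X\<^sub>1)\<close> is a coordinate complementary to \<open>X\<^sub>1\<close>, and \<open>F = b Z + f\<^sub>0(X\<^sub>1)\<close>.

  Applying \<open>D\<^sup>d\<close> to the last equation gives \<open>D\<^sup>d Z = - d! b\<^bsup>d-1\<^esup> f\<^sub>d\<close>, an element of \<open>A\<close>. With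
  \<open>D X\<^sub>1 = b\<close> it follows that the monomial \<open>X\<^sub>1\<^bsup>i\<^esup> Z\<^bsup>k\<^esup>\<close> survives exactly \<open>i + d k\<close> applications of \<open>D\<close>;
  call this number its weight \<open>w\<close>. The last nonzero derivative is
  \<open>w! b\<^bsup>w-k\<^esup> (- f\<^sub>d)\<^bsup>k\<^esup>\<close> (lemma \<open>top_derivative_monomial\<close>). For \<open>w = j\<close> only
  \<open>k \<le> l = j div d\<close> can occur, and up to a unit these derivatives are
  \<open>b\<^bsup>j-l\<^esup> \<cdot> b\<^bsup>l-k\<^esup> f\<^sub>d\<^bsup>k\<^esup>\<close>: the generators of \<open>b\<^bsup>j-l\<^esup> (b, f\<^sub>d)\<^bsup>l\<^esup>\<close>. Here \<open>j - l\<close> is the exponent \<open>m\<^sub>j\<close>, because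
  \<open>i + (d - 1) k = j - k\<close> is smallest for the largest \<open>k\<close>. As factorials are invertible, this
  gives one inclusion (\<open>generator_in_image\<close>).

  For the other inclusion, an element \<open>D\<^sup>j p\<close> of \<open>A\<close> satisfies \<open>D\<^bsup>j+1\<^esup> p = 0\<close>, and it suffices that
  such a \<open>p\<close> is an \<open>A\<close>-combination of monomials of weight at most \<open>j\<close> (\<open>reduce_weight\<close>). Write
  \<open>p\<close> as some \<open>A\<close>-combination of monomials, with top weight \<open>N > j\<close>, and let \<open>a X\<^sub>1\<^bsup>i\<^esup> Z\<^bsup>K\<^esup>\<close> be the term
  of weight \<open>N\<close> with the largest exponent \<open>K\<close>. In \<open>0 = D\<^sup>N p\<close> every other term has an
  additional factor \<open>b\<close>, so the prime \<open>b\<close>, which does not divide \<open>f\<^sub>d\<close>, divides \<open>a\<close> if \<open>K > 0\<close>; and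
  \<open>a = 0\<close> if \<open>K = 0\<close>. Then \<open>b Z = F - f\<^sub>0(X\<^sub>1)\<close> trades one factor \<open>Z\<close> for terms which have smaller
  weight, or the same weight and a smaller exponent of \<open>Z\<close> (\<open>reduce_top_monomial\<close>). This descent ends
  at weight \<open>j\<close>.

  Finally \<open>d \<ge> 2\<close>: irreducibility of \<open>D\<close> forbids that \<open>b\<close> divides \<open>f'\<close>, so \<open>d \<ge> 1\<close>; and \<open>d = 1\<close>
  would give \<open>D\<^sup>2 Z = 0 = D\<^sup>2 X\<^sub>1\<close>, making \<open>D\<close> 2-quasi-nice.
\<close>

section \<open>Spans over a set of coefficients\<close>

text \<open>
  The coefficients form a set because they will be the kernel of a derivation. Adding one summand at a
  time makes properties of linear combinations provable by rule induction.
\<close>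

inductive_set linear_span :: "'a::comm_ring_1 set \<Rightarrow> 'a set \<Rightarrow> 'a set"
  for A :: "'a set" and G :: "'a set" where
  zero: "0 \<in> linear_span A G"
| step: "c \<in> A \<Longrightarrow> g \<in> G \<Longrightarrow> p \<in> linear_span A G \<Longrightarrow> c * g + p \<in> linear_span A G"

lemma linear_span_add:
  assumes "p \<in> linear_span A G" and "q \<in> linear_span A G"
  shows "p + q \<in> linear_span A G"
  using assms(1)
proof induction
  case (step c g p)
  then show ?case
    using linear_span.step[of c A g G "p + q"] by (simp add: add.assoc)
qed (use assms(2) in simp)

lemma linear_span_generator:
  assumes "c \<in> A" and "g \<in> G"
  shows "c * g \<in> linear_span A G"
  using linear_span.step[OF assms linear_span.zero] by simp

lemma linear_span_sum:
  assumes "\<And>t. t \<in> T \<Longrightarrow> h t \<in> linear_span A G"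
  shows "sum h T \<in> linear_span A G"
  using assms by (induction T rule: infinite_finite_induct)
    (auto intro: linear_span_add linear_span.zero)

lemma linear_span_mono:
  assumes "p \<in> linear_span A G" and "G \<subseteq> H"
  shows "p \<in> linear_span A H"
  using assms(1) by induction (use assms(2) in \<open>auto intro: linear_span.intros\<close>)

lemma linear_span_times:
  assumes "p \<in> linear_span A G" and "\<And>c g. c \<in> A \<Longrightarrow> g \<in> G \<Longrightarrow> w * (c * g) \<in> linear_span A H"
  shows "w * p \<in> linear_span A H"
  using assms(1)
proof induction
  case zero
  then show ?case by (simp add: linear_span.zero)
next
  case (step c g p)
  then show ?case
    using linear_span_add[OF assms(2)[of c g] step.IH] by (simp add: distrib_left)
qed

lemma linear_span_insertE:
  assumes "p \<in> linear_span A (insert g G)"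
    and "0 \<in> A" and "\<And>x y. x \<in> A \<Longrightarrow> y \<in> A \<Longrightarrow> x + y \<in> A"
  obtains c q where "c \<in> A" and "q \<in> linear_span A G" and "p = c * g + q"
proof -
  from assms(1) have "\<exists>c q. c \<in> A \<and> q \<in> linear_span A G \<and> p = c * g + q"
  proof induction
    case zero
    then show ?case
      using assms(2) by (intro exI[of _ 0]) (simp add: linear_span.zero)
  next
    case (step c h p)
    then obtain e q where eq: "e \<in> A" "q \<in> linear_span A G" "p = e * g + q" by blast
    show ?case
    proof (cases "h = g")
      case True
      then show ?thesis
        using eq step.hyps assms(3)[of c e]
        by (intro exI[of _ "c + e"] exI[of _ q]) (simp add: algebra_simps)
    next
      case False
      then have "c * h + q \<in> linear_span A G"
        using step.hyps eq(2) by (auto intro: linear_span.step)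
      then show ?thesis
        using eq by (intro exI[of _ e] exI[of _ "c * h + q"]) (simp add: algebra_simps)
    qed
  qed
  then show ?thesis using that by blast
qed

section \<open>Iterated derivations\<close>

text \<open>
  For \<open>e \<noteq> 0\<close> in characteristic zero this says that \<open>p\<close> has degree \<open>n\<close> with respect to \<open>D\<close>. Recording
  \<open>D\<^sup>n p\<close> divided by \<open>n!\<close> makes the quantity \<open>e\<close> multiplicative, like a leading coefficient; \<open>e = 0\<close> is
  admitted.
\<close>

definition top_derivative ::
  "('a::comm_ring_1 \<Rightarrow> 'a) \<Rightarrow> nat \<Rightarrow> 'a \<Rightarrow> 'a \<Rightarrow> bool" where
  "top_derivative D n p e \<longleftrightarrow> (D ^^ n) p = of_nat (fact n) * e \<and> D e = 0"

locale leibniz =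
  fixes D :: "'a::comm_ring_1 \<Rightarrow> 'a"
  assumes add: "D (p + q) = D p + D q"
    and mult: "D (p * q) = p * D q + q * D p"
begin

lemma zero [simp]: "D 0 = 0"
  using add[of 0 0] by simp

lemma one [simp]: "D 1 = 0"
  using mult[of 1 1] by simp

lemma minus [simp]: "D (- p) = - D p"
  using add[of p "- p"] by (simp add: eq_neg_iff_add_eq_0 add.commute)

lemma of_nat [simp]: "D (of_nat n) = 0"
  by (induction n) (simp_all add: add)

lemma ker_power: "D c = 0 \<Longrightarrow> D (c ^ n) = 0"
  by (induction n) (simp_all add: mult)

lemma iter_zero [simp]: "(D ^^ n) 0 = 0"
  by (induction n) simp_all

lemma iter_add: "(D ^^ n) (p + q) = (D ^^ n) p + (D ^^ n) q"
  by (induction n) (simp_all add: add)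

lemma iter_scale: "D c = 0 \<Longrightarrow> (D ^^ n) (c * p) = c * (D ^^ n) p"
  by (induction n) (simp_all add: mult)

lemma iter_sum: "(D ^^ n) (sum h T) = (\<Sum>t\<in>T. (D ^^ n) (h t))"
  by (induction T rule: infinite_finite_induct) (simp_all add: iter_add)

text \<open>
  Of the Leibniz expansion of \<open>D\<^bsup>n+m\<^esup>(p q)\<close> only the term with \<open>D\<^sup>n p\<close> and \<open>D\<^sup>m q\<close> survives. Splitting
  \<open>D(p q) = p D q + q D p\<close> lowers one of \<open>n\<close> and \<open>m\<close> in each summand, and the two binomial
  coefficients add up by Pascal's rule.
\<close>

lemma iter_mult_top:
  assumes "(D ^^ Suc n) p = 0" and "(D ^^ Suc m) q = 0"
  shows "(D ^^ (n + m)) (p * q) = of_nat ((n + m) choose n) * ((D ^^ n) p * (D ^^ m) q)"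
  using assms
proof (induction "n + m" arbitrary: n m p q rule: less_induct)
  case less
  consider "n = 0" | "m = 0" | n' m' where "n = Suc n'" "m = Suc m'"
    by (metis not0_implies_Suc)
  then show ?case
  proof cases
    case 1
    then show ?thesis using less.prems by (simp add: iter_scale)
  next
    case 2
    then show ?thesis
      using less.prems iter_scale[of q n p] by (simp add: mult.commute)
  next
    case 3
    have l: "(D ^^ (n + m')) (p * D q)
        = of_nat ((n + m') choose n) * ((D ^^ n) p * (D ^^ m') (D q))"
      using less.prems 3 by (intro less.hyps) (simp_all add: funpow_swap1)
    have r: "(D ^^ (n' + m)) (D p * q)
        = of_nat ((n' + m) choose n') * ((D ^^ n') (D p) * (D ^^ m) q)"
      using less.prems 3 by (intro less.hyps) (simp_all add: funpow_swap1)
    have e: "n + m = Suc (n + m')" "n + m' = n' + m" using 3 by simp_all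
    have "(D ^^ (n + m)) (p * q) = (D ^^ (n + m')) (p * D q) + (D ^^ (n' + m)) (D p * q)"
      unfolding e(1) funpow_Suc_right o_apply mult iter_add e(2) by (simp add: mult.commute)
    also have "\<dots> = of_nat (((n + m') choose n) + ((n + m') choose n'))
        * ((D ^^ n) p * (D ^^ m) q)"
      unfolding l r using 3 by (simp add: funpow_swap1 algebra_simps)
    also have "((n + m') choose n) + ((n + m') choose n') = (n + m) choose n"
      using 3 by simp
    finally show ?thesis .
  qed
qed

lemma top_derivative_vanish:
  assumes "top_derivative D n p e" and "n < N"
  shows "(D ^^ N) p = 0"
proof -
  have "(D ^^ Suc n) p = 0"
    using assms(1) by (simp add: top_derivative_def mult)
  moreover obtain k where "N = k + Suc n"
    using assms(2) by (metis Suc_leI le_add_diff_inverse2)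
  ultimately show ?thesis by (simp only: funpow_add o_apply iter_zero)
qed

lemma top_derivative_mult:
  assumes "top_derivative D n p e" and "top_derivative D m q e'"
  shows "top_derivative D (n + m) (p * q) (e * e')"
proof -
  have "(D ^^ (n + m)) (p * q) = of_nat ((n + m) choose n) * ((D ^^ n) p * (D ^^ m) q)"
    using assms top_derivative_vanish by (intro iter_mult_top) blast+
  also have "\<dots> = of_nat (fact n * fact m * ((n + m) choose n)) * (e * e')"
    using assms by (simp add: top_derivative_def algebra_simps)
  also have "fact n * fact m * ((n + m) choose n) = (fact (n + m) :: nat)"
    using binomial_fact_lemma[of n "n + m"] by simp
  finally show ?thesis using assms by (simp add: top_derivative_def mult)
qed

lemma top_derivative_power:
  "top_derivative D n p e \<Longrightarrow> top_derivative D (n * i) (p ^ i) (e ^ i)"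
proof (induction i)
  case 0
  show ?case by (simp add: top_derivative_def)
next
  case (Suc i)
  then show ?case using top_derivative_mult[of n p e "n * i"] by simp
qed

end

section \<open>Weights and descent for triangular derivations\<close>

text \<open>
  The abstract form of \<open>D\<close> in the coordinates \<open>x = X\<^sub>1\<close> and \<open>z = Z\<close>: the relation places
  \<open>\<beta> z + \<Sum>\<^sub>t c\<^sub>t x\<^sup>t\<close> in the kernel, which determines \<open>D z\<close>, as \<open>\<beta>\<close> is not a zero divisor.
\<close>

locale triangular_derivation = leibniz D for D :: "'a::idom \<Rightarrow> 'a" +
  fixes x z \<beta> :: 'a and c :: "nat \<Rightarrow> 'a" and d :: nat
  assumes prime: "prime_elem \<beta>"
    and D_x: "D x = \<beta>"
    and ker_\<beta>: "D \<beta> = 0"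
    and ker_c: "D (c t) = 0"
    and ker_relation: "D (\<beta> * z + (\<Sum>t\<le>d. c t * x ^ t)) = 0"
    and d_pos: "0 < d"
    and not_dvd: "\<not> \<beta> dvd c d"
    and fact_unit: "of_nat (fact n) dvd (1::'a)"
begin

definition F :: 'a where "F = \<beta> * z + (\<Sum>t\<le>d. c t * x ^ t)"

text \<open>
  Monomials are ordered by weight and then by the exponent of \<open>z\<close>; this set is the initial segment
  below \<open>(N, K)\<close>. In particular \<open>K = 0\<close> leaves the monomials of weight less than \<open>N\<close>.
\<close>

definition monomials :: "nat \<Rightarrow> nat \<Rightarrow> 'a set" where
  "monomials N K = {x ^ i * z ^ k | i k. i + d * k < N \<or> i + d * k = N \<and> k < K}"

abbreviation span :: "nat \<Rightarrow> nat \<Rightarrow> 'a set" where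
  "span N K \<equiv> linear_span {a. D a = 0} (monomials N K)"

lemma span_monomial:
  assumes "D a = 0" and "i + d * k < N \<or> i + d * k = N \<and> k < K"
  shows "a * (x ^ i * z ^ k) \<in> span N K"
  using assms by (intro linear_span_generator) (auto simp: monomials_def)

lemma monomials_mono:
  assumes "\<And>i k. i + d * k < N \<or> i + d * k = N \<and> k < K
    \<Longrightarrow> i + d * k < N' \<or> i + d * k = N' \<and> k < K'"
  shows "monomials N K \<subseteq> monomials N' K'"
  unfolding monomials_def using assms by blast

lemma weight_ge: "i + d * k \<le> N \<Longrightarrow> k \<le> N"
  using d_pos mult_le_mono1[of 1 d k] by linarith

lemma top_derivative_x_power: "top_derivative D i (x ^ i) (\<beta> ^ i)"
proof -
  have "top_derivative D 1 x \<beta>" by (simp add: top_derivative_def D_x ker_\<beta>)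
  from top_derivative_power[OF this, of i] show ?thesis by simp
qed

text \<open>
  Apply \<open>D\<^sup>d\<close> to the relation and cancel \<open>\<beta>\<close>: the kernel element vanishes, as do the terms with
  \<open>t < d\<close>, and \<open>x\<^sup>d\<close> contributes \<open>d! \<beta>\<^sup>d\<close>.
\<close>

lemma top_derivative_z: "top_derivative D d z (- (\<beta> ^ (d - 1) * c d))"
proof -
  have low: "(D ^^ d) (c t * x ^ t) = 0" if "t < d" for t
    using top_derivative_vanish[OF top_derivative_x_power that] by (simp add: iter_scale ker_c)
  have "top_derivative D 0 F F"
    using ker_relation by (simp add: top_derivative_def F_def)
  from top_derivative_vanish[OF this d_pos] have "(D ^^ d) F = 0" .
  moreover have "F = \<beta> * z + ((\<Sum>t<d. c t * x ^ t) + c d * x ^ d)"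
    by (simp add: F_def lessThan_Suc_atMost[symmetric])
  moreover have "(D ^^ d) (\<Sum>t<d. c t * x ^ t) = 0"
    unfolding iter_sum by (rule sum.neutral) (simp add: low)
  ultimately have "\<beta> * (D ^^ d) z + c d * (D ^^ d) (x ^ d) = 0"
    by (simp add: iter_add iter_scale ker_c ker_\<beta>)
  moreover have "\<beta> ^ d = \<beta> * \<beta> ^ (d - 1)"
    using d_pos by (simp add: power_eq_if)
  ultimately have "\<beta> * (D ^^ d) z = \<beta> * (of_nat (fact d) * - (\<beta> ^ (d - 1) * c d))"
    using top_derivative_x_power[of d]
    by (simp add: top_derivative_def eq_neg_iff_add_eq_0 ac_simps)
  then have "(D ^^ d) z = of_nat (fact d) * - (\<beta> ^ (d - 1) * c d)"
    using prime mult_left_cancel[of \<beta>] by (metis prime_elem_not_zeroI)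
  then show ?thesis
    by (simp add: top_derivative_def mult ker_power ker_\<beta> ker_c)
qed

lemma top_derivative_monomial:
  "top_derivative D (i + d * k) (x ^ i * z ^ k) (\<beta> ^ (i + (d - 1) * k) * (- c d) ^ k)"
proof -
  have "\<beta> ^ i * (- (\<beta> ^ (d - 1) * c d)) ^ k = \<beta> ^ (i + (d - 1) * k) * (- c d) ^ k"
    by (simp add: power_add power_mult flip: power_mult_distrib)
  then show ?thesis
    using top_derivative_mult[OF top_derivative_x_power top_derivative_power[OF top_derivative_z]]
    by metis
qed

lemma span_vanish:
  assumes "q \<in> span N 0"
  shows "(D ^^ N) q = 0"
  using assms
proof induction
  case (step a g p)
  then obtain i k where g: "g = x ^ i * z ^ k" "i + d * k < N" by (auto simp: monomials_def)
  then show ?case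
    using step top_derivative_vanish[OF top_derivative_monomial g(2)]
    by (simp add: iter_add iter_scale)
qed simp

text \<open>
  A monomial of weight \<open>N\<close> contributes \<open>\<beta>\<^bsup>N-k\<^esup>\<close>, and \<open>k < K\<close>: the terms with a smaller exponent of
  \<open>z\<close> are more divisible by \<open>\<beta>\<close> than the one with exponent \<open>K\<close>.
\<close>

lemma span_top_dvd:
  assumes "q \<in> span N K" and "K \<le> N"
  shows "\<beta> ^ (N - K + 1) dvd (D ^^ N) q"
  using assms(1)
proof induction
  case (step a g p)
  then obtain i k where g: "g = x ^ i * z ^ k" "i + d * k < N \<or> i + d * k = N \<and> k < K"
    unfolding monomials_def by blast
  have "\<beta> ^ (N - K + 1) dvd (D ^^ N) g"
  proof (cases "i + d * k < N")
    case True
    then show ?thesis using top_derivative_vanish[OF top_derivative_monomial True] g by simp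
  next
    case False
    then have w: "i + d * k = N" "k < K" using g by auto
    then have "N - K + 1 \<le> i + (d - 1) * k"
      using assms(2) d_pos by (simp add: diff_mult_distrib)
    then have "\<beta> ^ (N - K + 1) dvd \<beta> ^ (i + (d - 1) * k)" by (rule le_imp_power_dvd)
    moreover have "(D ^^ N) g = of_nat (fact N) * (\<beta> ^ (i + (d - 1) * k) * (- c d) ^ k)"
      using top_derivative_monomial[of i k] w g by (simp only: top_derivative_def)
    ultimately show ?thesis by (simp only: dvd_mult dvd_mult2)
  qed
  then show ?case using step by (simp add: iter_add iter_scale)
qed simp

text \<open>
  The descent step. If \<open>D\<^sup>N\<close> kills \<open>p\<close>, its coefficient \<open>a\<close> at the largest monomial is a multiple of
  \<open>\<beta>\<close>, and one factor \<open>\<beta> z\<close> can be rewritten as \<open>F - \<Sum>\<^sub>t c\<^sub>t x\<^sup>t\<close>. The quotient of \<open>a\<close> by \<open>\<beta>\<close> is again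
  in the kernel, so the new coefficients are too.
\<close>

lemma reduce_top_monomial:
  assumes p: "p \<in> span N (Suc K)" and vanish: "(D ^^ N) p = 0"
  shows "p \<in> span N K"
proof (cases "d * K \<le> N")
  case False
  have "monomials N (Suc K) \<subseteq> monomials N K"
    using False by (intro monomials_mono) (auto simp: less_Suc_eq)
  then show ?thesis using p by (rule linear_span_mono[rotated])
next
  case True
  define i where "i = N - d * K"
  have i: "i + d * K = N" using True by (simp add: i_def)
  have KN: "K \<le> N" using i weight_ge[of i K] by simp
  have "monomials N (Suc K) \<subseteq> insert (x ^ i * z ^ K) (monomials N K)"
  proof
    fix g assume "g \<in> monomials N (Suc K)"
    then obtain i' k where "g = x ^ i' * z ^ k"
      and "i' + d * k < N \<or> i' + d * k = N \<and> k < K \<or> i' = i \<and> k = K"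
      using i unfolding monomials_def by (force simp: less_Suc_eq)
    then show "g \<in> insert (x ^ i * z ^ K) (monomials N K)"
      unfolding monomials_def by blast
  qed
  then have "p \<in> linear_span {a. D a = 0} (insert (x ^ i * z ^ K) (monomials N K))"
    using p by (rule linear_span_mono[rotated])
  then obtain a q where a: "D a = 0" and q: "q \<in> span N K" and pq: "p = a * (x ^ i * z ^ K) + q"
    by (elim linear_span_insertE) (auto simp: add)
  have exponent: "i + (d - 1) * K = N - K"
    using i d_pos by (simp add: diff_mult_distrib)
  have top: "(D ^^ N) p = \<beta> ^ (N - K) * (of_nat (fact N) * a * (- c d) ^ K) + (D ^^ N) q"
    using top_derivative_monomial[of i K] unfolding i exponent
    by (simp add: pq iter_add iter_scale a top_derivative_def ac_simps)
  show ?thesis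
  proof (cases K)
    case 0
    have "\<beta> ^ N * (of_nat (fact N) * a) = 0"
      using top vanish span_vanish[of q N] q 0 by simp
    moreover have "of_nat (fact N) \<noteq> (0::'a)" using fact_unit[of N] by force
    ultimately have "a = 0" using prime by auto
    then show ?thesis using pq q by simp
  next
    case (Suc K')
    have "\<beta> ^ (N - K + 1) dvd \<beta> ^ (N - K) * (of_nat (fact N) * a * (- c d) ^ K)"
      using span_top_dvd[OF q KN] top vanish by (metis dvd_0_right dvd_add_left_iff)
    then have "\<beta> dvd of_nat (fact N) * a * (- c d) ^ K"
      using prime by (simp add: prime_elem_def mult.assoc)
    moreover have "\<not> \<beta> dvd of_nat (fact N)"
      using prime fact_unit[of N] by (meson dvd_trans prime_elem_not_unit)
    moreover have "\<not> \<beta> dvd (- c d) ^ K"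
      using prime not_dvd prime_elem_dvd_power[of \<beta> "- c d" K] by auto
    ultimately have "\<beta> dvd a" using prime prime_elem_dvd_multD by blast
    then obtain a' where a': "a = \<beta> * a'" by (rule dvdE)
    \<comment> \<open>From \<open>0 = D (\<beta> a') = \<beta> D a'\<close>.\<close>
    then have ker_a': "D a' = 0" using a prime by (simp add: mult ker_\<beta>)
    have "a * (x ^ i * z ^ K) = a' * x ^ i * z ^ K' * (\<beta> * z)"
      by (simp add: a' Suc ac_simps)
    also have "\<beta> * z = F - (\<Sum>t\<le>d. c t * x ^ t)" by (simp add: F_def)
    also have "a' * x ^ i * z ^ K' * (F - (\<Sum>t\<le>d. c t * x ^ t))
        = a' * F * (x ^ i * z ^ K') + (\<Sum>t\<le>d. - (a' * c t) * (x ^ (i + t) * z ^ K'))"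
      by (simp add: right_diff_distrib sum_distrib_left sum_negf power_add ac_simps)
    \<comment> \<open>The summand \<open>t = d\<close> keeps the weight \<open>N\<close> but has \<open>K
      - 1\<close> factors \<open>z\<close>; all other terms have smaller weight.\<close>
    also have "\<dots> \<in> span N K"
    proof (intro linear_span_add linear_span_sum span_monomial)
      show "D (a' * F) = 0" using ker_a' ker_relation by (simp add: mult F_def)
      show "i + d * K' < N \<or> i + d * K' = N \<and> K' < K" using i Suc by auto
    next
      fix t assume "t \<in> {..d}"
      show "D (- (a' * c t)) = 0" using ker_a' by (simp add: mult ker_c)
      show "i + t + d * K' < N \<or> i + t + d * K' = N \<and> K' < K"
        using \<open>t \<in> {..d}\<close> i Suc by auto
    qed
    finally show ?thesis unfolding pq using q by (rule linear_span_add)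
  qed
qed

lemma reduce_weight:
  assumes "p \<in> span N 0" and "(D ^^ Suc j) p = 0"
  shows "p \<in> span (Suc j) 0"
  using assms(1)
proof (induction N)
  case 0
  have "monomials 0 0 \<subseteq> monomials (Suc j) 0" by (intro monomials_mono) auto
  then show ?case using 0 by (rule linear_span_mono[rotated])
next
  case (Suc N)
  show ?case
  proof (cases "N \<le> j")
    case True
    then have "monomials (Suc N) 0 \<subseteq> monomials (Suc j) 0" by (intro monomials_mono) auto
    then show ?thesis using Suc.prems by (rule linear_span_mono[rotated])
  next
    case False
    then have vanish: "(D ^^ N) p = 0"
      using assms(2) by (metis funpow_add iter_zero le_add_diff_inverse2 not_less_eq_eq o_apply)
    have "monomials (Suc N) 0 \<subseteq> monomials N (Suc N)"
    proof (intro monomials_mono)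
      fix i k assume "i + d * k < Suc N \<or> i + d * k = Suc N \<and> k < 0"
      then show "i + d * k < N \<or> i + d * k = N \<and> k < Suc N"
        using weight_ge[of i k N] by linarith
    qed
    then have p: "p \<in> span N (Suc N)" using Suc.prems by (rule linear_span_mono[rotated])
    \<comment> \<open>All exponents of \<open>z\<close> in weight \<open>N\<close> are eliminated, from
      the largest down.\<close>
    have "p \<in> span N K \<Longrightarrow> p \<in> span N 0" for K
      by (induction K) (use reduce_top_monomial vanish in blast)+
    then show ?thesis using p Suc.IH by blast
  qed
qed


text \<open>
  These closure properties show that the spans exhaust the whole ring once it is generated by \<open>x\<close>,
  \<open>z\<close> and constants of \<open>D\<close>.
\<close>

lemma span_union_closed:
  assumes "p \<in> (\<Union>N. span N 0)"
  shows "D a = 0 \<Longrightarrow> a * p \<in> (\<Union>N. span N 0)"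
    and "x * p \<in> (\<Union>N. span N 0)"
    and "z * p \<in> (\<Union>N. span N 0)"
    and "q \<in> (\<Union>N. span N 0) \<Longrightarrow> p + q \<in> (\<Union>N. span N 0)"
proof -
  obtain N where N: "p \<in> span N 0" using assms by blast
  have shift: "w * p \<in> (\<Union>N. span N 0)"
    if "\<And>a i k. D a = 0 \<Longrightarrow> i + d * k < N \<Longrightarrow> w * (a * (x ^ i * z ^ k)) \<in> span M 0" for w M
  proof -
    have "w * p \<in> span M 0"
      using N by (rule linear_span_times) (use that in \<open>auto simp: monomials_def\<close>)
    then show ?thesis by blast
  qed
  show "a * p \<in> (\<Union>N. span N 0)" if "D a = 0"
  proof (rule shift[where M = N])
    fix e i k assume "D e = 0" "i + d * k < N"
    then show "a * (e * (x ^ i * z ^ k)) \<in> span N 0"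
      using span_monomial[of "a * e" i k N 0] that by (simp add: mult ac_simps)
  qed
  show "x * p \<in> (\<Union>N. span N 0)"
  proof (rule shift[where M = "Suc N"])
    fix e i k assume "D e = 0" "i + d * k < N"
    then show "x * (e * (x ^ i * z ^ k)) \<in> span (Suc N) 0"
      using span_monomial[of e "Suc i" k "Suc N" 0] by (simp add: ac_simps)
  qed
  show "z * p \<in> (\<Union>N. span N 0)"
  proof (rule shift[where M = "N + d"])
    fix e i k assume "D e = 0" "i + d * k < N"
    then show "z * (e * (x ^ i * z ^ k)) \<in> span (N + d) 0"
      using span_monomial[of e i "Suc k" "N + d" 0] by (simp add: ac_simps)
  qed
  show "p + q \<in> (\<Union>N. span N 0)" if q: "q \<in> (\<Union>N. span N 0)"
  proof -
    obtain M where M: "q \<in> span M 0" using q by blast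
    have "monomials N 0 \<subseteq> monomials (max N M) 0" "monomials M 0 \<subseteq> monomials (max N M) 0"
      by (intro monomials_mono; auto)+
    then have "p + q \<in> span (max N M) 0"
      using N M by (blast intro: linear_span_add linear_span_mono)
    then show ?thesis by blast
  qed
qed

definition image_generators :: "nat \<Rightarrow> 'a set" where
  "image_generators l = (\<lambda>k. \<beta> ^ (l - k) * c d ^ k) ` {..l}"

text \<open>
  The power \<open>\<beta>\<^bsup>j-k\<^esup>\<close> is split so that its first factor is independent of the monomial; the second
  exponent is a natural number because \<open>k \<le> j div d\<close>.
\<close>

lemma iter_monomial_top:
  assumes "i + d * k = j"
  shows "k \<le> j div d"
    and "(D ^^ j) (x ^ i * z ^ k)
      = \<beta> ^ (j - j div d) * (of_nat (fact j) * (- 1) ^ k * (\<beta> ^ (j div d - k) * c d ^ k))"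
proof -
  have "k * d \<le> j" using assms by (simp add: mult.commute)
  then show k: "k \<le> j div d" using d_pos by (simp add: less_eq_div_iff_mult_less_eq)
  have "i + (d - 1) * k = j - k"
    using assms d_pos by (auto simp: diff_mult_distrib)
  also have "j - k = (j - j div d) + (j div d - k)"
    using k div_le_dividend[of j d] by simp
  finally have "\<beta> ^ (i + (d - 1) * k) = \<beta> ^ (j - j div d) * \<beta> ^ (j div d - k)"
    by (simp only: power_add)
  moreover have "(D ^^ j) (x ^ i * z ^ k)
      = of_nat (fact j) * (\<beta> ^ (i + (d - 1) * k) * (- c d) ^ k)"
    using top_derivative_monomial[of i k] unfolding assms by (simp only: top_derivative_def)
  ultimately show "(D ^^ j) (x ^ i * z ^ k)
      = \<beta> ^ (j - j div d) * (of_nat (fact j) * (- 1) ^ k * (\<beta> ^ (j div d - k) * c d ^ k))"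
    by (simp only: power_minus[of "c d"] ac_simps)
qed

lemma top_image_in_span:
  assumes "p \<in> span N 0" and "(D ^^ Suc j) p = 0"
  shows "(D ^^ j) p \<in> (*) (\<beta> ^ (j - j div d))
    ` linear_span {a. D a = 0} (image_generators (j div d))"
  using reduce_weight[OF assms]
proof induction
  case zero
  show ?case by (auto intro: linear_span.zero rev_image_eqI)
next
  case (step a g p)
  then obtain i k where g: "g = x ^ i * z ^ k" "i + d * k < Suc j" by (auto simp: monomials_def)
  from step.IH obtain q where q: "q \<in> linear_span {a. D a = 0} (image_generators (j div d))"
    "(D ^^ j) p = \<beta> ^ (j - j div d) * q" by blast
  show ?case
  proof (cases "i + d * k = j")
    case False
    then have "(D ^^ j) g = 0"
      using g top_derivative_vanish[OF top_derivative_monomial, of i k j] by simp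
    then show ?thesis using step by (simp add: iter_add iter_scale)
  next
    case True
    note top = iter_monomial_top[OF True]
    have "a * (of_nat (fact j) * (- 1) ^ k) * (\<beta> ^ (j div d - k) * c d ^ k) + q
        \<in> linear_span {a. D a = 0} (image_generators (j div d))"
      using step.hyps top(1) q(1)
      by (intro linear_span.step) (auto simp: mult ker_power image_generators_def)
    moreover have "(D ^^ j) (a * g + p) = \<beta> ^ (j - j div d)
        * (a * (of_nat (fact j) * (- 1) ^ k) * (\<beta> ^ (j div d - k) * c d ^ k) + q)"
      using step.hyps by (simp add: iter_add iter_scale g(1) top(2) q(2) algebra_simps)
    ultimately show ?thesis by blast
  qed
qed

text \<open>
  The preimage is the monomial \<open>x\<^bsup>j-dk\<^esup> z\<^bsup>k\<^esup>\<close>, divided by \<open>j!\<close> and with the sign \<open>(- 1)\<^bsup>k\<^esup>\<close> removed.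
\<close>

lemma generator_in_image:
  assumes "k \<le> j div d"
  shows "\<beta> ^ (j - j div d) * (\<beta> ^ (j div d - k) * c d ^ k) \<in> range (D ^^ j)"
proof -
  obtain u where u: "of_nat (fact j) * u = (1::'a)" using fact_unit[of j] by (metis dvdE)
  \<comment> \<open>The inverse \<open>u\<close> of \<open>j!\<close> is a constant of \<open>D\<close>,
    so that it can be moved through \<open>D\<^sup>j\<close>.\<close>
  have "of_nat (fact j) * D u = D (of_nat (fact j) * u)" by (simp add: mult)
  then have "of_nat (fact j) * D u = 0" by (simp add: u)
  moreover have "of_nat (fact j) \<noteq> (0::'a)" using fact_unit[of j] by force
  ultimately have "D u = 0" by simp
  then have ker: "D ((- 1) ^ k * u) = 0" by (simp add: mult ker_power)
  have "k * d \<le> j" using assms d_pos by (simp add: less_eq_div_iff_mult_less_eq)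
  then have "(j - d * k) + d * k = j" by (simp add: mult.commute)
  note top = iter_monomial_top(2)[OF this]
  have "(- 1) ^ k * (- 1) ^ k = (1::'a)" by (simp flip: power_mult_distrib)
  moreover have "(D ^^ j) ((- 1) ^ k * u * (x ^ (j - d * k) * z ^ k))
      = ((- 1) ^ k * (- 1) ^ k) * (of_nat (fact j) * u)
        * (\<beta> ^ (j - j div d) * (\<beta> ^ (j div d - k) * c d ^ k))"
    unfolding iter_scale[OF ker] top by (simp only: ac_simps)
  ultimately have "(D ^^ j) ((- 1) ^ k * u * (x ^ (j - d * k) * z ^ k))
      = \<beta> ^ (j - j div d) * (\<beta> ^ (j div d - k) * c d ^ k)"
    by (simp only: u mult_1)
  then show ?thesis by (metis rangeI)
qed

end

section \<open>Derivations of the polynomial ring in two variables\<close>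

lemma const2_mult: "const2 (r * s) = const2 r * const2 s"
  and const2_add: "const2 (r + s) = const2 r + const2 s"
  by simp_all

lemma const2_power: "const2 (r ^ n) = const2 r ^ n"
  by (simp add: poly_const_pow)

text \<open>
  An induction principle: \<open>R[X\<^sub>1, X\<^sub>2]\<close> is generated by \<open>X\<^sub>1\<close> and \<open>X\<^sub>2 + g(X\<^sub>1)\<close> over \<open>R\<close>. Closure under
  \<open>R[X\<^sub>1]\<close> comes first, and then \<open>X\<^sub>2 = (X\<^sub>2 + g) - g\<close>.
\<close>

lemma poly_poly_generated:
  fixes S :: "'r::comm_ring_1 poly poly set"
  assumes one: "1 \<in> S"
    and add: "\<And>p q. p \<in> S \<Longrightarrow> q \<in> S \<Longrightarrow> p + q \<in> S"
    and const: "\<And>r p. p \<in> S \<Longrightarrow> const2 r * p \<in> S"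
    and X1: "\<And>p. p \<in> S \<Longrightarrow> X1 * p \<in> S"
    and Z: "\<And>p. p \<in> S \<Longrightarrow> (X2 + [:g:]) * p \<in> S"
  shows "p \<in> S"
proof -
  have inner: "[:a:] * q \<in> S" if "q \<in> S" for a q
  proof (induction a)
    case 0
    show ?case using const[OF that, of 0] by simp
  next
    case (pCons r a)
    have "[:pCons r a:] * q = const2 r * q + X1 * ([:a:] * q)"
      by (simp add: smult_add_left[symmetric])
    then show ?case using add const that X1 pCons.IH by metis
  qed
  have X2: "X2 * q \<in> S" if "q \<in> S" for q
  proof -
    have "X2 * q = (X2 + [:g:]) * q + [:- g:] * q" by (simp add: algebra_simps)
    then show ?thesis using add Z inner that by metis
  qed
  show ?thesis
  proof (induction p)
    case 0
    show ?case using const[OF one, of 0] by simp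
  next
    case (pCons a p)
    have "pCons a p = [:a:] * 1 + X2 * p" by simp
    then show ?case using add inner[OF one] X2 pCons.IH by metis
  qed
qed

lemma triangular_coordinate_system:
  "coordinate_system (\<lambda>i. if i = 1 then X1 else X2 + [:g:])"
proof -
  let ?Y = "\<lambda>i::nat. if i = 1 then X1 else X2 + [:g:]"
  have "T = UNIV" if "is_subring T" "range const2 \<union> ?Y ` {1..2} \<subseteq> T" for T :: "'a poly poly set"
  proof -
    have "?Y 1 \<in> T" "?Y 2 \<in> T"
      by (rule subsetD[OF that(2)]; force)+
    then have gens: "X1 \<in> T" "X2 + [:g:] \<in> T" by simp_all
    have const: "const2 r \<in> T" for r using that(2) by blast
    have mult: "p * q \<in> T" if "p \<in> T" "q \<in> T" for p q
      using \<open>is_subring T\<close> that by (simp add: is_subring_def)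
    have "p \<in> T" for p
    proof (rule poly_poly_generated[where g = g])
      show "X1 * q \<in> T" if "q \<in> T" for q
        using gens(1) that by (rule mult)
      show "(X2 + [:g:]) * q \<in> T" if "q \<in> T" for q
        using gens(2) that by (rule mult)
    qed (use \<open>is_subring T\<close> mult const in \<open>simp_all add: is_subring_def del: mult_pCons_left\<close>)
    then show ?thesis by blast
  qed
  then show ?thesis unfolding coordinate_system_def hull_def by blast
qed

lemma derivation_leibniz: "derivation D \<Longrightarrow> leibniz D"
  by unfold_locales (simp_all add: derivation_def)

lemma derivation_const2:
  assumes "derivation D"
  shows "D (const2 r) = 0"
proof -
  interpret leibniz D using assms by (rule derivation_leibniz)
  have "D (const2 r * 1) = const2 r * D 1"
    using assms unfolding derivation_def by blast
  then show ?thesis by simp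
qed

lemma derivation_inner:
  assumes "derivation D" and "D X1 = const2 b"
  shows "D [:p:] = [:pderiv p:] * const2 b"
proof -
  interpret leibniz D using assms(1) by (rule derivation_leibniz)
  show ?thesis
  proof (induction p)
    case 0
    show ?case by simp
  next
    case (pCons a p)
    have "[:pCons a p:] = const2 a + X1 * [:p:]" by simp
    then have "D [:pCons a p:] = X1 * D [:p:] + [:p:] * const2 b"
      by (simp only: add mult derivation_const2[OF assms(1)] assms(2) add_0)
    also have "\<dots> = [:pderiv (pCons a p):] * const2 b"
      unfolding pCons.IH by (simp add: pderiv_pCons algebra_simps)
    finally show ?case .
  qed
qed

text \<open>
  By the chain rule \<open>D p\<close> is a combination of \<open>D X\<^sub>1\<close> and \<open>D X\<^sub>2\<close>; here this becomes an induction over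
  the generators.
\<close>

lemma derivation_range_dvd:
  assumes "derivation D" and "q dvd D X1" and "q dvd D X2"
  shows "q dvd D p"
proof -
  interpret leibniz D using assms(1) by (rule derivation_leibniz)
  have "p \<in> {p. q dvd D p}"
    by (rule poly_poly_generated[where g = 0])
      (use assms(2,3) in \<open>simp_all only: mem_Collect_eq one add mult derivation_const2[OF assms(1)]
        pCons_0_0 add_0_right mult_zero_right dvd_0_right dvd_add dvd_mult dvd_mult2\<close>)
  then show ?thesis by simp
qed

lemma inner_poly_as_sum: "[:\<Sum>t\<le>d. monom (h t) t:] = (\<Sum>t\<le>d. const2 (h t) * X1 ^ t)"
proof -
  have sum: "[:sum w T:] = (\<Sum>t\<in>T. [:w t:])" for w :: "nat \<Rightarrow> 'a poly" and T
  proof (induction T rule: infinite_finite_induct)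
    case (insert t T)
    have "[:w t + sum w T:] = [:w t:] + [:sum w T:]" by simp
    then show ?case using insert.IH by (simp only: sum.insert[OF insert.hyps])
  qed simp_all
  have "[:monom r t:] = const2 r * X1 ^ t" for r :: 'a and t
    by (simp add: monom_altdef poly_const_pow)
  then show ?thesis by (simp add: sum)
qed

lemma fact_unit_of_algebra:
  fixes \<phi> :: "'k::field_char_0 \<Rightarrow> 'r::comm_ring_1"
  assumes "is_ring_hom \<phi>"
  shows "of_nat (fact n) dvd (1::'r)"
proof -
  have hom: "\<phi> 1 = 1" "\<phi> (x + y) = \<phi> x + \<phi> y" "\<phi> (x * y) = \<phi> x * \<phi> y" for x y
    using assms by (auto simp: is_ring_hom_def)
  have "\<phi> 0 = 0" using hom(2)[of 0 0] by simp
  then have nat: "\<phi> (of_nat m) = of_nat m" for m by (induction m) (simp_all add: hom)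
  have "of_nat (fact n) * \<phi> (inverse (of_nat (fact n))) = \<phi> (of_nat (fact n) * inverse (of_nat (fact n)))"
    by (simp only: hom nat)
  also have "\<dots> = 1" by (simp add: hom)
  finally show ?thesis by (metis dvdI)
qed

section \<open>Powers of an ideal with two generators\<close>

lemma is_ideal_hull:
  assumes "is_ideal A A" and "S \<subseteq> A"
  shows "is_ideal A (is_ideal A hull S)"
  using assms unfolding hull_def by (auto simp: is_ideal_def)

lemma ideal_power_generators:
  assumes "k \<le> l"
  shows "r ^ (l - k) * s ^ k \<in> ideal_power UNIV (is_ideal UNIV hull {r, s}) l"
  using assms
proof (induction l arbitrary: k)
  case 0
  show ?case by simp
next
  case (Suc l)
  let ?I = "is_ideal UNIV hull {r, s}"
  have gens: "r \<in> ?I" "s \<in> ?I" by (simp_all add: hull_inc)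
  have product: "x * y \<in> ideal_power UNIV ?I (Suc l)" if "x \<in> ?I" "y \<in> ideal_power UNIV ?I l" for x y
    using that by (auto intro!: hull_inc)
  show ?case
  proof (cases k)
    case 0
    then show ?thesis using product[OF gens(1) Suc.IH[of 0]] by simp
  next
    case (Suc k')
    then show ?thesis
      using product[OF gens(2) Suc.IH[of k']] Suc.prems by (simp add: ac_simps)
  qed
qed

text \<open>
  Together with the previous lemma: the power \<open>(r, s)\<^sup>l\<close> is the ideal generated by the products
  \<open>r\<^bsup>l-k\<^esup> s\<^bsup>k\<^esup>\<close>. In the induction step, the induction hypothesis is applied to the ideal of all \<open>y\<close> with
  \<open>r y \<in> K\<close> and \<open>s y \<in> K\<close>; the first factor is then handled by the ideal of all \<open>x\<close> with \<open>x y \<in> K\<close>.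
\<close>

lemma ideal_power_minimal:
  assumes "is_ideal UNIV K" and "\<And>k. k \<le> l \<Longrightarrow> r ^ (l - k) * s ^ k \<in> K"
  shows "ideal_power UNIV (is_ideal UNIV hull {r, s}) l \<subseteq> K"
  using assms
proof (induction l arbitrary: K)
  case 0
  then have "1 \<in> K" by fastforce
  then show ?case using 0(1) unfolding is_ideal_def by fastforce
next
  case (Suc l)
  let ?I = "is_ideal UNIV hull {r, s}"
  have scale: "a * x \<in> K" and sum: "x \<in> K \<Longrightarrow> y \<in> K \<Longrightarrow> x + y \<in> K" if "x \<in> K" for a x y
    using Suc.prems(1) that by (auto simp: is_ideal_def)
  have K0: "0 \<in> K" using Suc.prems(1) by (simp add: is_ideal_def)
  have "x * y \<in> K" if "x \<in> ?I" and y: "y \<in> ideal_power UNIV ?I l" for x y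
  proof -
    have "is_ideal UNIV {y. r * y \<in> K \<and> s * y \<in> K}"
    proof -
      have "r * (a * x) \<in> K \<and> s * (a * x) \<in> K" if "r * x \<in> K" "s * x \<in> K" for a x
        using scale that by (simp add: mult.left_commute[of _ a])
      then show ?thesis
        unfolding is_ideal_def using K0 sum by (simp add: distrib_left)
    qed
    moreover have "r ^ (l - k) * s ^ k \<in> {y. r * y \<in> K \<and> s * y \<in> K}" if "k \<le> l" for k
      using Suc.prems(2)[of k] Suc.prems(2)[of "Suc k"] that
      by (simp add: Suc_diff_le ac_simps)
    ultimately have "ideal_power UNIV ?I l \<subseteq> {y. r * y \<in> K \<and> s * y \<in> K}" by (rule Suc.IH)
    then have "{r, s} \<subseteq> {x. x * y \<in> K}" using y by auto
    moreover have "is_ideal UNIV {x. x * y \<in> K}"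
      unfolding is_ideal_def using K0 scale sum by (auto simp: distrib_right mult.assoc)
    ultimately have "?I \<subseteq> {x. x * y \<in> K}" by (rule hull_minimal)
    then show ?thesis using \<open>x \<in> ?I\<close> by blast
  qed
  then have "{x * y |x y. x \<in> ?I \<and> y \<in> ideal_power UNIV ?I l} \<subseteq> K" by blast
  then show ?case using Suc.prems(1) by (simp add: hull_minimal)
qed

lemma linear_span_subset_ideal:
  assumes "is_ideal A I" and "G \<subseteq> I"
  shows "linear_span A G \<subseteq> I"
proof
  fix p assume "p \<in> linear_span A G"
  then show "p \<in> I" by induction (use assms in \<open>auto simp: is_ideal_def\<close>)
qed


section \<open>The image ideals\<close>

lemma Ker_is_ideal: "derivation D \<Longrightarrow> is_ideal (Ker D) (Ker D)"
proof -
  assume "derivation D"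
  then interpret leibniz D by (rule derivation_leibniz)
  show "is_ideal (Ker D) (Ker D)" by (auto simp: is_ideal_def Ker_def add mult)
qed

lemma image_ideal_is_ideal:
  assumes "derivation D"
  shows "is_ideal (Ker D) (image_ideal D j)"
proof -
  interpret leibniz D using assms by (rule derivation_leibniz)
  have "p + q \<in> range (D ^^ j)" if "p \<in> range (D ^^ j)" "q \<in> range (D ^^ j)" for p q
    using that by (auto simp flip: iter_add)
  moreover have "a * p \<in> range (D ^^ j)" if "D a = 0" "p \<in> range (D ^^ j)" for a p
    using that by (auto simp flip: iter_scale)
  moreover have "0 \<in> range (D ^^ j)" by (metis iter_zero rangeI)
  ultimately show ?thesis
    by (auto simp: is_ideal_def image_ideal_def Ker_def add mult)
qed

text \<open>
  On the solutions of \<open>i\<^sub>1 + d i\<^sub>2 = j\<close> the value is \<open>j - i\<^sub>2\<close>, and the largest possible \<open>i\<^sub>2\<close> is \<open>j div d\<close>.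
\<close>

lemma least_weight_exponent:
  fixes d j :: nat
  assumes "2 \<le> d"
  shows "(LEAST n. \<exists>i\<^sub>1 i\<^sub>2. n = i\<^sub>1 + (d - 1) * i\<^sub>2 \<and> i\<^sub>1 + d * i\<^sub>2 = j) = j - j div d"
proof (rule Least_equality)
  have "d * (j div d) = (d - 1) * (j div d) + j div d"
    using assms by (cases d) simp_all
  then have "j - j div d = j mod d + (d - 1) * (j div d)"
    using mod_mult_div_eq[of j d] by linarith
  then show "\<exists>i\<^sub>1 i\<^sub>2. j - j div d = i\<^sub>1 + (d - 1) * i\<^sub>2 \<and> i\<^sub>1 + d * i\<^sub>2 = j"
    using mod_mult_div_eq[of j d] by blast
next
  fix n assume "\<exists>i\<^sub>1 i\<^sub>2. n = i\<^sub>1 + (d - 1) * i\<^sub>2 \<and> i\<^sub>1 + d * i\<^sub>2 = j"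
  then obtain i k where n: "n = i + (d - 1) * k" and j: "i + d * k = j" by blast
  have "k * d \<le> j" using j by (simp add: mult.commute)
  then have "k \<le> j div d" using assms by (simp add: less_eq_div_iff_mult_less_eq)
  moreover have "n + k = j" using n j assms by (cases d) simp_all
  ultimately show "j - j div d \<le> n" by linarith
qed

text \<open>
  It remains to produce the coordinate \<open>Z\<close>, to derive \<open>d \<ge> 2\<close>, and to translate the description of
  \<open>D\<^sup>j p\<close> by generators into the ideal generated by a power of \<open>(b, f\<^sub>d)\<close>.
\<close>

theorem theorem5p2:
  fixes \<phi> :: "'k::field_char_0 \<Rightarrow> 'r::{idom, factorial_semiring}"
    and D :: "'r poly poly \<Rightarrow> 'r poly poly"
    and A :: "'r poly poly set"
    and b :: 'r
    and f :: "'r poly"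
    and m d :: nat
  assumes "finitely_generated_algebra \<phi>"
    and "locally_nilpotent_derivation D"
    and "irreducible_derivation D"
    and "\<not> fixed_point_free D"
    and "A = Ker D"
    and "D X1 = const2 b" and "irreducible b"
    and "D X2 = - [:pderiv f:]" and "f = (\<Sum>i\<le>m. monom (coeff f i) i)" and "coeff f m \<noteq> 0"
    and "strictly_quasi_nice 1 D"
    and "d = Max {i. i \<le> m \<and> \<not> b dvd coeff f i}"
  shows "d \<ge> 2 \<and>
    (\<forall>j\<ge>2.
      let m\<^sub>j = (LEAST n. \<exists>i\<^sub>1 i\<^sub>2. n = i\<^sub>1 + (d - 1) * i\<^sub>2 \<and> i\<^sub>1 + d * i\<^sub>2 = j);
          l\<^sub>j = j div d;
          Ibar = is_ideal A hull
            (const2 ` ideal_power UNIV (is_ideal UNIV hull {b, coeff f d}) l\<^sub>j)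
      in image_ideal D j = (\<lambda>x. const2 b ^ m\<^sub>j * x) ` Ibar)"
proof -
  have der: "derivation D" using assms(2) by (simp add: locally_nilpotent_derivation_def)
  then interpret leibniz D by (rule derivation_leibniz)
  note const = derivation_const2[OF der]
  have prime_b: "prime_elem b" using assms(7) by (rule irreducible_imp_prime_elem)

  let ?S = "{i. i \<le> m \<and> \<not> b dvd coeff f i}"
  have outside: "b dvd coeff f i" if "i \<notin> ?S" for i
  proof (cases "i \<le> m")
    case False
    have "coeff f i = coeff (\<Sum>i\<le>m. monom (coeff f i) i) i" by (rule arg_cong[OF assms(9)])
    also have "\<dots> = 0" using False by (simp add: coeff_sum)
    finally show ?thesis by simp
  qed (use that in simp)
  \<comment> \<open>Otherwise \<open>b\<close> divides \<open>f'\<close> and hence all of \<open>D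
    B\<close>, against irreducibility. So the maximum \<open>d\<close> is taken over a
    nonempty set and is positive.\<close>
  have "\<exists>i\<in>?S. 1 \<le> i"
  proof (rule ccontr)
    assume no_index: "\<not> (\<exists>i\<in>?S. 1 \<le> i)"
    have "b dvd coeff (pderiv f) n" for n
      using outside[of "Suc n"] no_index unfolding coeff_pderiv by (intro dvd_mult) force
    then have "[:b:] dvd pderiv f" by (simp add: const_poly_dvd_iff)
    then have "const2 b dvd D X2"
      unfolding assms(8) by (simp only: dvd_minus_iff const_poly_dvd_const_poly_iff)
    then have "const2 b dvd D p" for p
      using derivation_range_dvd[OF der] by (simp add: assms(6))
    then have "range D \<subseteq> range ((*) (const2 b))"
      unfolding dvd_def by blast
    moreover have "\<not> const2 b dvd 1"
      using prime_b by (simp add: prime_elem_def one_pCons)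
    ultimately show False using assms(3) unfolding irreducible_derivation_def by blast
  qed
  then obtain i where i: "i \<in> ?S" "1 \<le> i" by blast
  have fin: "finite ?S" by simp
  have d_S: "d \<in> ?S" using Max_in[OF fin] i assms(12) by blast
  have d_max: "i \<le> d" if "i \<in> ?S" for i using Max_ge[OF fin that] assms(12) by simp
  have d1: "0 < d" using d_max[OF i(1)] i(2) by simp

  let ?low = "\<Sum>t\<le>d. monom (coeff f t) t"
  have "[:b:] dvd f - ?low"
    unfolding const_poly_dvd_iff
  proof
    fix n show "b dvd coeff (f - ?low) n"
      using outside[of n] d_max[of n] by (cases "n \<le> d") (auto simp: coeff_sum)
  qed
  then obtain g where g: "f = ?low + [:b:] * g" by (metis add_diff_cancel_left' add.commute diff_add_cancel dvdE)
  define z where "z = X2 + [:g:]"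
  define c where "c t = const2 (coeff f t)" for t
  \<comment> \<open>The decomposition of \<open>F\<close> that puts \<open>D\<close> into the abstract
    form.\<close>
  have relation: "const2 b * z + (\<Sum>t\<le>d. c t * X1 ^ t) = const2 b * X2 + [:f:]"
  proof -
    have "(\<Sum>t\<le>d. c t * X1 ^ t) = [:?low:]" by (simp only: c_def inner_poly_as_sum)
    moreover have "[:f:] = [:?low:] + const2 b * [:g:]" by (subst g) simp
    ultimately show ?thesis by (simp only: z_def distrib_left ac_simps)
  qed
  have "D (const2 b * X2 + [:f:]) = 0"
    by (simp only: add mult const assms(8) derivation_inner[OF der assms(6)]) simp
  then have ker_F: "D (const2 b * z + (\<Sum>t\<le>d. c t * X1 ^ t)) = 0"
    by (simp only: relation)
  have hom: "is_ring_hom \<phi>" using assms(1) by (simp add: finitely_generated_algebra_def)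
  interpret triangular_derivation D X1 z "const2 b" c d
  proof
    show "of_nat (fact n) dvd (1 :: 'r poly poly)" for n
      using fact_unit_of_algebra[OF hom, of n]
      unfolding of_nat_poly one_pCons const_poly_dvd_const_poly_iff .
  qed (use prime_b d_S d1 const assms(6) ker_F in \<open>simp_all add: c_def lift_prime_elem_poly\<close>)

  have d2: "2 \<le> d"
  proof (rule ccontr)
    assume "\<not> 2 \<le> d"
    then have "d = 1" using d1 by simp
    \<comment> \<open>By its top derivative, \<open>Z\<close> is killed by \<open>D\<^bsup>d+1\<^esup> =
      D\<^sup>2\<close>, so \<open>X\<^sub>1\<close> and \<open>Z\<close> are coordinates
      with vanishing second derivative.\<close>
    then have "(D ^^ 2) z = 0" using top_derivative_vanish[OF top_derivative_z, of 2] by simp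
    moreover have "(D ^^ 2) X1 = 0" by (simp add: numeral_2_eq_2 assms(6) const)
    ultimately have "quasi_nice 2 D"
      unfolding quasi_nice_def using assms(2) triangular_coordinate_system[of g]
      by (auto simp: z_def intro!: exI[of _ "\<lambda>i. if i = 1 then X1 else X2 + [:g:]"])
    then show False using assms(11) by (simp add: strictly_quasi_nice_def)
  qed

  have exhaust: "p \<in> (\<Union>N. span N 0)" for p
  proof (rule poly_poly_generated[where g = g])
    have "1 * (X1 ^ 0 * z ^ 0) \<in> span 1 0" by (rule span_monomial) simp_all
    then show "1 \<in> (\<Union>N. span N 0)" by auto
  qed (use span_union_closed const in \<open>auto simp only: z_def[symmetric]\<close>)

  have ker: "{a. D a = 0} = A" by (simp add: assms(5) Ker_def)
  have "image_ideal D j = (\<lambda>x. const2 b ^ (j - j div d) * x) `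
      (is_ideal A hull (const2 ` ideal_power UNIV (is_ideal UNIV hull {b, coeff f d}) (j div d)))"
    (is "_ = ?scale ` (is_ideal A hull ?J)") for j
  proof
    have ideal_A: "is_ideal A A" unfolding assms(5) using der by (rule Ker_is_ideal)
    have J_A: "?J \<subseteq> A" using const by (auto simp: assms(5) Ker_def)
    have generators: "const2 b ^ (j div d - k) * c d ^ k
        = const2 (b ^ (j div d - k) * coeff f d ^ k)" for k
      by (simp only: c_def const2_mult const2_power)
    show "image_ideal D j \<subseteq> ?scale ` (is_ideal A hull ?J)"
    proof
      fix y assume y: "y \<in> image_ideal D j"
      then obtain p where p: "y = (D ^^ j) p" "(D ^^ Suc j) p = 0"
        by (auto simp: image_ideal_def Ker_def)
      obtain N where "p \<in> span N 0" using exhaust by blast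
      then have "y \<in> ?scale ` linear_span A (image_generators (j div d))"
        using top_image_in_span[OF _ p(2)] p(1) ker by auto
      moreover have "image_generators (j div d) \<subseteq> is_ideal A hull ?J"
        unfolding image_generators_def generators
        by (auto intro!: hull_inc imageI[where f = "\<lambda>r. const2 r"] ideal_power_generators)
      ultimately show "y \<in> ?scale ` (is_ideal A hull ?J)"
        using linear_span_subset_ideal[OF is_ideal_hull[OF ideal_A J_A]] by blast
    qed
    have ideal_image: "is_ideal A (image_ideal D j)"
      unfolding assms(5) using der by (rule image_ideal_is_ideal)
    \<comment> \<open>The constants whose multiple by \<open>b\<^bsup>m\<^sub>j\<^esup>\<close> is in
      \<open>I\<^sub>j\<close> form an ideal of \<open>R\<close>, which can be tested on
      the generators of \<open>(b, f\<^sub>d)\<^bsup>l\<^esup>\<close>; the elements of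
      \<open>A\<close> with this property form an ideal of \<open>A\<close>.\<close>
    have "is_ideal UNIV {r. ?scale (const2 r) \<in> image_ideal D j}"
    proof -
      have "?scale (const2 (r + s)) \<in> image_ideal D j"
        if "?scale (const2 r) \<in> image_ideal D j" "?scale (const2 s) \<in> image_ideal D j" for r s
        using ideal_image that unfolding is_ideal_def const2_add distrib_left by blast
      moreover have "?scale (const2 (r * s)) \<in> image_ideal D j"
        if "?scale (const2 s) \<in> image_ideal D j" for r s
        using ideal_image that const
        unfolding is_ideal_def const2_mult mult.left_commute[of "const2 b ^ _"] assms(5) Ker_def
        by blast
      moreover have "?scale (const2 0) \<in> image_ideal D j"
        using ideal_image by (simp add: is_ideal_def)
      ultimately show ?thesis unfolding is_ideal_def by blast
    qed
    moreover have "b ^ (j div d - k) * coeff f d ^ k \<in> {r. ?scale (const2 r) \<in> image_ideal D j}"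
      if "k \<le> j div d" for k
      using generator_in_image[OF that] unfolding generators
      by (simp add: image_ideal_def Ker_def mult ker_power const
          del: mult_pCons_left mult_pCons_right)
    ultimately have "?J \<subseteq> {y. ?scale y \<in> image_ideal D j}"
      using ideal_power_minimal by blast
    moreover have "is_ideal A {y \<in> A. ?scale y \<in> image_ideal D j}"
    proof -
      have "?scale (y + w) \<in> image_ideal D j"
        if "?scale y \<in> image_ideal D j" "?scale w \<in> image_ideal D j" for y w
        using ideal_image that unfolding is_ideal_def distrib_left by blast
      moreover have "?scale (a * y) \<in> image_ideal D j"
        if "a \<in> A" "?scale y \<in> image_ideal D j" for a y
        using ideal_image that unfolding is_ideal_def mult.left_commute[of "const2 b ^ _"] by blast
      moreover have "?scale 0 \<in> image_ideal D j" using ideal_image by (simp add: is_ideal_def)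
      ultimately show ?thesis using ideal_A unfolding is_ideal_def by blast
    qed
    ultimately show "?scale ` (is_ideal A hull ?J) \<subseteq> image_ideal D j"
      using hull_minimal[of ?J "{y \<in> A. ?scale y \<in> image_ideal D j}" "is_ideal A"] J_A by blast
  qed
  then show ?thesis
    using d2 unfolding Let_def least_weight_exponent[OF d2] by blast
qed

end
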